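(* There is an arithmetical functional $F$ of type $(1\times1)\to0$ (i.e. $F:\mathbb N^{\mathbb N}\times\mathbb N^{\mathbb N}\to\mathbb N$) such that for every Pincherle realiser $M$, the function $G$ defined by $G(f)=M(\lambda g.F(f,g))$ is not Borel measurable.
   Context: $C=2^{\mathbb N}$ is Cantor space. For $f\in C$ and $n\in\mathbb N$, $\overline{f}n=\langle f(0),\dots,f(n-1)\rangle$, and $[\sigma]$ is the set of $g\in C$ extending the finite binary sequence $\sigma$. For $F,G:C\to\mathbb N$, $\mathsf{LOC}(F,G)$ means $(\forall f,g\in C)\big(g\in[\overline{f}G(f)]\to F(g)\le G(f)\big)$. A Pincherle realiser (PR) is a functional $M$ assigning natural numbers to functionals $G:C\to\mathbb N$ such that $(\forall F,G:C\to\mathbb N)\big(\mathsf{LOC}(F,G)\to(\forall g\in C)(F(g)\le M(G))\big)$. "Arithmetical" means definable by a formula of first-order arithmetic (with function arguments as parameters). A functional is Borel measurable if its graph is a Borel set (equivalently, preimages of open sets are Borel). *)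

theory Defs
  imports "HOL-Analysis.Analysis"
begin

text \<open>Cantor space is rendered as the type nat \<Rightarrow> bool; Baire space as nat \<Rightarrow> nat
  (with the product topology of discrete nat, so its Borel sets are the usual ones).\<close>

definition LOC :: "((nat \<Rightarrow> bool) \<Rightarrow> nat) \<Rightarrow> ((nat \<Rightarrow> bool) \<Rightarrow> nat) \<Rightarrow> bool" where
  "LOC F G \<longleftrightarrow> (\<forall>f g. (\<forall>i < G f. g i = f i) \<longrightarrow> F g \<le> G f)"

definition pincherle_realiser :: "(((nat \<Rightarrow> bool) \<Rightarrow> nat) \<Rightarrow> nat) \<Rightarrow> bool" where
  "pincherle_realiser M \<longleftrightarrow> (\<forall>F G. LOC F G \<longrightarrow> (\<forall>g. F g \<le> M G))"

datatype atrm = AVar nat | AZero | ASuc atrm | APlus atrm atrm | ATimes atrm atrm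
  | AppF atrm | AppG atrm

datatype afm = AEq atrm atrm | ALess atrm atrm | ANeg afm | AAnd afm afm | AEx nat afm

primrec eval_trm :: "(nat \<Rightarrow> nat) \<Rightarrow> (nat \<Rightarrow> nat) \<Rightarrow> (nat \<Rightarrow> nat) \<Rightarrow> atrm \<Rightarrow> nat" where
  "eval_trm f g e (AVar x) = e x"
| "eval_trm f g e AZero = 0"
| "eval_trm f g e (ASuc t) = Suc (eval_trm f g e t)"
| "eval_trm f g e (APlus s t) = eval_trm f g e s + eval_trm f g e t"
| "eval_trm f g e (ATimes s t) = eval_trm f g e s * eval_trm f g e t"
| "eval_trm f g e (AppF t) = f (eval_trm f g e t)"
| "eval_trm f g e (AppG t) = g (eval_trm f g e t)"

primrec sat :: "(nat \<Rightarrow> nat) \<Rightarrow> (nat \<Rightarrow> nat) \<Rightarrow> (nat \<Rightarrow> nat) \<Rightarrow> afm \<Rightarrow> bool" where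
  "sat f g e (AEq s t) = (eval_trm f g e s = eval_trm f g e t)"
| "sat f g e (ALess s t) = (eval_trm f g e s < eval_trm f g e t)"
| "sat f g e (ANeg p) = (\<not> sat f g e p)"
| "sat f g e (AAnd p q) = (sat f g e p \<and> sat f g e q)"
| "sat f g e (AEx x p) = (\<exists>n. sat f g (e(x := n)) p)"

definition arithmetical2 :: "((nat \<Rightarrow> nat) \<Rightarrow> (nat \<Rightarrow> nat) \<Rightarrow> nat) \<Rightarrow> bool" where
  "arithmetical2 F \<longleftrightarrow> (\<exists>\<phi>. \<forall>f g n. F f g = n \<longleftrightarrow> sat f g ((\<lambda>_. 0)(0 := n)) \<phi>)"

definition nat_of_bool_seq :: "(nat \<Rightarrow> bool) \<Rightarrow> (nat \<Rightarrow> nat)" where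
  "nat_of_bool_seq g = (\<lambda>n. if g n then 1 else 0)"

end

theory Submission
  imports Defs
begin

text \<open>
  Suppose that the function H obtained from some realiser is Borel. Let the point c code, for all n
  at once, well-founded codes of the Borel sets \<open>{x. H x = n}\<close>, whose basic tests are carried out
  on c itself. A point g of Cantor space is read as a claimed evaluation: row p of g says that node p
  is true, or names the least witness against p. Let \<open>g0\<close> be the correct evaluation. Every g falls
  under one of three arithmetical cases. If g has a locally visible error, a finite part of g
  distinguishes it from \<open>g0\<close>. If it has no such error but has blank rows, then below a
  minimal blank row p everything is correct by well-founded induction, and no witness against p
  exists, so \<open>g0\<close> declares p true at a place where g is blank. Otherwise g is correct and reveals
  the value \<open>H c\<close>, and the radius can be chosen larger than it. Thus every neighbourhood containing
  \<open>g0\<close> has a radius above \<open>H c\<close>, which forces the realiser to exceed its own value at c.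
\<close>

section \<open>Well-founded Borel codes\<close>

text \<open>With joint denial as the only connective, an inner node is false exactly when some child
  is true, so one index is enough evidence against it.\<close>

datatype bcode = Test nat nat | Nor "nat \<Rightarrow> bcode"

primrec holds :: "(nat \<Rightarrow> nat) \<Rightarrow> bcode \<Rightarrow> bool" where
  "holds x (Test i j) \<longleftrightarrow> x i \<noteq> j"
| "holds x (Nor b) \<longleftrightarrow> (\<forall>n. \<not> holds x (b n))"

lemma holds_complement: "- {x. holds x b} = {x. holds x (Nor (\<lambda>_. b))}"
  by auto

lemma borel_imp_bcode:
  fixes A :: "(nat \<Rightarrow> nat) set"
  assumes "A \<in> sets borel"
  shows "\<exists>b. A = {x. holds x b}"
proof -
  \<comment> \<open>Its children demand both \<open>x 0 = 0\<close> and
    \<open>x 0 \<noteq> 0\<close>.\<close>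
  define never where "never = Nor (\<lambda>n. if n = 0 then Test 0 0 else Nor (\<lambda>_. Test 0 0))"
  have never: "\<not> holds x never" for x
    unfolding never_def by (auto split: if_splits)
  have "A \<in> sets (PiM UNIV (\<lambda>_::nat. borel :: nat measure))"
    using assms by (simp add: sets_PiM_equal_borel)
  then have "A \<in> sigma_sets UNIV {{x. x i \<in> B} | i B. B \<in> sets borel}"
    by (simp add: sets_PiM_single)
  then show ?thesis
  proof (induction A rule: sigma_sets.induct)
    case (Basic A)
    then obtain i and B :: "nat set" where A: "A = {x. x i \<in> B}" by blast
    \<comment> \<open>Membership in B is the conjunction of \<open>x i \<noteq> j\<close> over all j
      outside B.\<close>
    have "A = {x. holds x (Nor (\<lambda>j. if j \<in> B then never else Nor (\<lambda>_. Test i j)))}"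
      using never by (auto simp: A)
    then show ?case by blast
  next
    case Empty
    then show ?case using never by blast
  next
    case (Compl A)
    then show ?case using holds_complement by (metis Compl_eq_Diff_UNIV)
  next
    case (Union A)
    then obtain b where b: "\<And>n. A n = {x. holds x (b n)}" by metis
    have "(\<Union>n. A n) = {x. holds x (Nor (\<lambda>_. Nor b))}"
      by (auto simp: b)
    then show ?case by blast
  qed
qed

definition subcode :: "(bcode \<times> bcode) set" where
  "subcode = {(b n, Nor b) | b n. True}"

lemma wf_subcode: "wf subcode"
proof (rule wfUNIVI)
  fix P :: "bcode \<Rightarrow> bool" and b
  assume step: "\<forall>x. (\<forall>y. (y, x) \<in> subcode \<longrightarrow> P y) \<longrightarrow> P x"
  show "P b"
  proof (induction b)
    case (Test i j)
    show ?case using step[rule_format, of "Test i j"] by (simp add: subcode_def)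
  next
    case (Nor b)
    show ?case using step[rule_format, of "Nor b"] Nor by (auto simp: subcode_def)
  qed
qed

text \<open>The path has its latest step first. A leaf absorbs further steps, so every list names a
  node.\<close>

primrec subterm :: "bcode \<Rightarrow> nat list \<Rightarrow> bcode" where
  "subterm b [] = b"
| "subterm b (n # ns) = (case subterm b ns of Test i j \<Rightarrow> Test i j | Nor d \<Rightarrow> d n)"

section \<open>The functional\<close>

text \<open>An injective pairing that is a polynomial, hence a term of the language of arithmetic.\<close>

definition qpair :: "nat \<Rightarrow> nat \<Rightarrow> nat" where
  "qpair a b = (a + b) * (a + b) + a"

text \<open>As \<open>qpair a b\<close> lies between the squares of \<open>a + b\<close> and
  \<open>Suc (a + b)\<close>, it determines the sum, and then a.\<close>

lemma qpair_inject [simp]: "qpair a b = qpair c d \<longleftrightarrow> a = c \<and> b = d"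
proof
  have less: "qpair a b < qpair c d" if "a + b < c + d" for a b c d
  proof -
    have "qpair a b < Suc (a + b) * Suc (a + b)" by (simp add: qpair_def)
    also have "\<dots> \<le> (c + d) * (c + d)" using that by (intro mult_le_mono) auto
    finally show ?thesis by (simp add: qpair_def)
  qed
  assume eq: "qpair a b = qpair c d"
  then have "a + b = c + d" using less by (metis less_irrefl linorder_neqE_nat)
  then show "a = c \<and> b = d" using eq by (simp add: qpair_def)
qed simp

lemma qpair_mono2: "b \<le> d \<Longrightarrow> qpair a b \<le> qpair a d"
  by (simp add: qpair_def mult_le_mono)

lemma nat_of_bool_seq_pos [simp]: "nat_of_bool_seq g x > 0 \<longleftrightarrow> g x"
  by (simp add: nat_of_bool_seq_def)

text \<open>
  A point f describes a set of nodes: \<open>f (qpair 0 (qpair p q))\<close> is nonzero if q is a proper descendant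
  of p, \<open>f (qpair 1 (qpair p m))\<close> is the m-th child of p, \<open>f (qpair 2 p)\<close> is 0 at an inner node and
  \<open>Suc j\<close> at a leaf testing \<open>f i \<noteq> j\<close>, where \<open>i = f (qpair 3 p)\<close>. In a claimed evaluation g, entry 0
  of row p says that p is true, and entry \<open>Suc m\<close> that m is the least witness against p.
\<close>

definition witness :: "(nat \<Rightarrow> nat) \<Rightarrow> (nat \<Rightarrow> nat) \<Rightarrow> nat \<Rightarrow> nat \<Rightarrow> bool" where
  "witness f g p m \<longleftrightarrow> f (qpair 2 p) = Suc (f (f (qpair 3 p))) \<or>
     f (qpair 2 p) = 0 \<and> g (qpair (f (qpair 1 (qpair p m))) 0) > 0"

text \<open>The bound on k makes every clash visible on finitely many entries of g. A row may name
  several witnesses if all are genuine.\<close>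

definition clash :: "(nat \<Rightarrow> nat) \<Rightarrow> (nat \<Rightarrow> nat) \<Rightarrow> nat \<Rightarrow> nat \<Rightarrow> bool" where
  "clash f g p m \<longleftrightarrow>
     g (qpair p (Suc m)) > 0 \<and> \<not> witness f g p m \<or>
     witness f g p m \<and> (g (qpair p 0) > 0 \<or> \<not> (\<exists>k<Suc m. g (qpair p (Suc k)) > 0))"

definition blank :: "(nat \<Rightarrow> nat) \<Rightarrow> nat \<Rightarrow> bool" where
  "blank g p \<longleftrightarrow> \<not> (\<exists>k. g (qpair p k) > 0)"

definition radius_ok :: "(nat \<Rightarrow> nat) \<Rightarrow> (nat \<Rightarrow> nat) \<Rightarrow> nat \<Rightarrow> bool" where
  "radius_ok f g n \<longleftrightarrow>
     (\<exists>p m. clash f g p m \<and> qpair p (Suc m) < n \<and> qpair (f (qpair 1 (qpair p m))) 0 < n) \<or>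
     \<not> (\<exists>p m. clash f g p m) \<and>
       ((\<exists>p. blank g p \<and> \<not> (\<exists>q. f (qpair 0 (qpair p q)) > 0 \<and> blank g q) \<and> qpair p 0 < n) \<or>
        \<not> (\<exists>p. blank g p) \<and> (\<exists>m<n. witness f g 0 m))"

definition radius :: "(nat \<Rightarrow> nat) \<Rightarrow> (nat \<Rightarrow> nat) \<Rightarrow> nat" where
  "radius f g = (if \<exists>n. radius_ok f g n then LEAST n. radius_ok f g n else 0)"

lemma radius_eq_iff:
  "radius f g = n \<longleftrightarrow>
     radius_ok f g n \<and> \<not> (\<exists>k<n. radius_ok f g k) \<or> n = 0 \<and> \<not> (\<exists>k. radius_ok f g k)"
proof (cases "\<exists>n. radius_ok f g n")
  case True
  then have "radius f g = n \<longleftrightarrow> radius_ok f g n \<and> \<not> (\<exists>k<n. radius_ok f g k)"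
    unfolding radius_def
    by (metis LeastI_ex Least_le linorder_neqE_nat not_less_Least)
  with True show ?thesis by blast
qed (auto simp: radius_def)

section \<open>Arithmetical definability\<close>

abbreviation AOr :: "afm \<Rightarrow> afm \<Rightarrow> afm" where
  "AOr a b \<equiv> ANeg (AAnd (ANeg a) (ANeg b))"

abbreviation ANonzero :: "atrm \<Rightarrow> afm" where
  "ANonzero t \<equiv> ANeg (AEq t AZero)"

definition qpair_trm :: "atrm \<Rightarrow> atrm \<Rightarrow> atrm" where
  "qpair_trm a b = APlus (ATimes (APlus a b) (APlus a b)) a"

lemma eval_qpair_trm [simp]:
  "eval_trm f g e (qpair_trm a b) = qpair (eval_trm f g e a) (eval_trm f g e b)"
  by (simp add: qpair_trm_def qpair_def)

definition child_trm :: "atrm \<Rightarrow> atrm \<Rightarrow> atrm" where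
  "child_trm p m = AppF (qpair_trm (ASuc AZero) (qpair_trm p m))"

lemma eval_child_trm [simp]:
  "eval_trm f g e (child_trm p m) = f (qpair 1 (qpair (eval_trm f g e p) (eval_trm f g e m)))"
  by (simp add: child_trm_def)

definition witness_fm :: "atrm \<Rightarrow> atrm \<Rightarrow> afm" where
  "witness_fm p m =
     (let label = AppF (qpair_trm (ASuc (ASuc AZero)) p) in
      AOr (AEq label (ASuc (AppF (AppF (qpair_trm (ASuc (ASuc (ASuc AZero))) p)))))
        (AAnd (AEq label AZero) (ANonzero (AppG (qpair_trm (child_trm p m) AZero)))))"

lemma sat_witness_fm [simp]:
  "sat f g e (witness_fm p m) \<longleftrightarrow> witness f g (eval_trm f g e p) (eval_trm f g e m)"
  by (auto simp: witness_fm_def witness_def Let_def numeral_2_eq_2 numeral_3_eq_3)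

text \<open>Variable 9 is reserved for bound occurrences here, and 2 and 3 in
  \<open>radius_ok_fm\<close>; this explains the side conditions on variable names.\<close>

definition clash_fm :: "nat \<Rightarrow> nat \<Rightarrow> afm" where
  "clash_fm p m =
     AOr (AAnd (ANonzero (AppG (qpair_trm (AVar p) (ASuc (AVar m)))))
            (ANeg (witness_fm (AVar p) (AVar m))))
       (AAnd (witness_fm (AVar p) (AVar m))
         (AOr (ANonzero (AppG (qpair_trm (AVar p) AZero)))
           (ANeg (AEx 9 (AAnd (ALess (AVar 9) (ASuc (AVar m)))
              (ANonzero (AppG (qpair_trm (AVar p) (ASuc (AVar 9))))))))))"

lemma sat_clash_fm [simp]:
  "p \<noteq> 9 \<Longrightarrow> m \<noteq> 9 \<Longrightarrow> sat f g e (clash_fm p m) \<longleftrightarrow> clash f g (e p) (e m)"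
  by (auto simp: clash_fm_def clash_def)

definition blank_fm :: "nat \<Rightarrow> afm" where
  "blank_fm p = ANeg (AEx 9 (ANonzero (AppG (qpair_trm (AVar p) (AVar 9)))))"

lemma sat_blank_fm [simp]: "p \<noteq> 9 \<Longrightarrow> sat f g e (blank_fm p) \<longleftrightarrow> blank g (e p)"
  by (simp add: blank_fm_def blank_def)

definition radius_ok_fm :: "nat \<Rightarrow> afm" where
  "radius_ok_fm n =
     AOr (AEx 2 (AEx 3 (AAnd (clash_fm 2 3)
           (AAnd (ALess (qpair_trm (AVar 2) (ASuc (AVar 3))) (AVar n))
             (ALess (qpair_trm (child_trm (AVar 2) (AVar 3)) AZero) (AVar n))))))
       (AAnd (ANeg (AEx 2 (AEx 3 (clash_fm 2 3))))
         (AOr (AEx 2 (AAnd (blank_fm 2)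
                (AAnd (ANeg (AEx 3 (AAnd
                         (ANonzero (AppF (qpair_trm AZero (qpair_trm (AVar 2) (AVar 3)))))
                         (blank_fm 3))))
                  (ALess (qpair_trm (AVar 2) AZero) (AVar n)))))
           (AAnd (ANeg (AEx 2 (blank_fm 2)))
             (AEx 2 (AAnd (ALess (AVar 2) (AVar n)) (witness_fm AZero (AVar 2)))))))"

lemma sat_radius_ok_fm [simp]:
  "n < 2 \<Longrightarrow> sat f g e (radius_ok_fm n) \<longleftrightarrow> radius_ok f g (e n)"
  unfolding radius_ok_fm_def radius_ok_def by (simp, blast)

lemma arithmetical2_radius: "arithmetical2 radius"
  unfolding arithmetical2_def
proof (intro exI allI)
  fix f g n
  show "radius f g = n \<longleftrightarrow> sat f g ((\<lambda>_. 0)(0 := n))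
    (AOr (AAnd (radius_ok_fm 0)
           (ANeg (AEx 1 (AAnd (ALess (AVar 1) (AVar 0)) (radius_ok_fm 1)))))
      (AAnd (AEq (AVar 0) AZero) (ANeg (AEx 1 (radius_ok_fm 1)))))"
    unfolding radius_eq_iff by simp
qed

section \<open>Evaluating a well-founded code\<close>

locale coded_point =
  fixes c :: "nat \<Rightarrow> nat" and dec :: "nat \<Rightarrow> bcode"
  assumes desc: "c (qpair 0 (qpair p q)) > 0 \<longleftrightarrow> (dec q, dec p) \<in> subcode\<^sup>+"
    and leaf: "dec p = Test i j \<Longrightarrow> c (qpair 2 p) = Suc j \<and> c (qpair 3 p) = i"
    and inner: "dec p = Nor b \<Longrightarrow> c (qpair 2 p) = 0 \<and> dec (c (qpair 1 (qpair p m))) = b m"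
begin

definition below :: "(nat \<times> nat) set" where
  "below = {(q, p). c (qpair 0 (qpair p q)) > 0}"

lemma wf_below: "wf below"
proof -
  have "below = inv_image (subcode\<^sup>+) dec" by (auto simp: below_def desc)
  then show ?thesis by (simp add: wf_subcode wf_trancl)
qed

lemma trans_below: "trans below"
  unfolding below_def desc trans_def by auto

lemma child_below: "dec p = Nor b \<Longrightarrow> (c (qpair 1 (qpair p m)), p) \<in> below"
  using inner[of p b m] by (auto simp: below_def desc subcode_def)

abbreviation true_node :: "nat \<Rightarrow> bool" where
  "true_node p \<equiv> holds c (dec p)"

lemma true_node_iff:
  assumes "\<And>b m. dec p = Nor b \<Longrightarrow>
      g (qpair (c (qpair 1 (qpair p m))) 0) > 0 \<longleftrightarrow> true_node (c (qpair 1 (qpair p m)))"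
  shows "true_node p \<longleftrightarrow> \<not> (\<exists>m. witness c g p m)"
proof (cases "dec p")
  case (Test i j)
  then show ?thesis using leaf[OF Test] by (auto simp: witness_def)
next
  case (Nor b)
  then show ?thesis using assms[OF Nor] inner[OF Nor] by (auto simp: witness_def)
qed

text \<open>By induction along \<open>below\<close>: a nonblank row either claims truth, which
  excludes witnesses, or names a witness, which must be genuine.\<close>

lemma no_clash_imp_correct:
  assumes no_clash: "\<not> (\<exists>p m. clash c g p m)"
    and nonblank: "\<not> blank g p" "\<And>q. (q, p) \<in> below \<Longrightarrow> \<not> blank g q"
  shows "g (qpair p 0) > 0 \<longleftrightarrow> true_node p"
  using nonblank
proof (induction p rule: wf_induct_rule[OF wf_below])
  case (1 p)
  have "g (qpair q 0) > 0 \<longleftrightarrow> true_node q" if "(q, p) \<in> below" for q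
    using 1 that trans_below by (metis transD)
  then have true: "true_node p \<longleftrightarrow> \<not> (\<exists>m. witness c g p m)"
    by (intro true_node_iff) (use child_below in blast)
  obtain k where k: "g (qpair p k) > 0" using 1 by (auto simp: blank_def)
  show ?case
  proof (cases k)
    case 0
    then show ?thesis using k no_clash true by (auto simp: clash_def)
  next
    case (Suc m)
    then have "witness c g p m" using k no_clash unfolding clash_def by blast
    then show ?thesis using no_clash true by (auto simp: clash_def)
  qed
qed

text \<open>At a false leaf every number is a witness, since \<open>witness\<close> then ignores its last argument.\<close>

definition refuted_by :: "nat \<Rightarrow> nat \<Rightarrow> bool" where
  "refuted_by p m \<longleftrightarrow> \<not> true_node p \<and>
     (\<forall>b. dec p = Nor b \<longrightarrow> true_node (c (qpair 1 (qpair p m))))"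

definition evaluation :: "nat \<Rightarrow> bool" where
  "evaluation x \<longleftrightarrow> (\<exists>p. x = qpair p 0 \<and> true_node p) \<or>
     (\<exists>p m. x = qpair p (Suc m) \<and> refuted_by p m \<and> \<not> (\<exists>k<m. refuted_by p k))"

lemma evaluation_0 [simp]: "evaluation (qpair p 0) \<longleftrightarrow> true_node p"
  by (auto simp: evaluation_def)

lemma evaluation_Suc [simp]:
  "evaluation (qpair p (Suc m)) \<longleftrightarrow> refuted_by p m \<and> \<not> (\<exists>k<m. refuted_by p k)"
  by (auto simp: evaluation_def)

lemma witness_evaluation:
  "witness c (nat_of_bool_seq evaluation) p m \<longleftrightarrow> refuted_by p m"
proof (cases "dec p")
  case (Test i j)
  then show ?thesis using leaf[OF Test] by (auto simp: witness_def refuted_by_def)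
next
  case (Nor b)
  then show ?thesis using inner[OF Nor]
    by (auto simp: witness_def refuted_by_def)
qed

lemma no_clash_evaluation: "\<not> clash c (nat_of_bool_seq evaluation) p m"
proof -
  have "\<exists>k<Suc m. refuted_by p k \<and> \<not> (\<exists>l<k. refuted_by p l)" if "refuted_by p m"
    using that exists_least_iff[of "refuted_by p"]
    by (metis less_Suc_eq linorder_neqE_nat)
  moreover have "\<not> true_node p" if "refuted_by p m"
    using that by (simp add: refuted_by_def)
  ultimately show ?thesis
    by (auto simp: clash_def witness_evaluation)
qed

text \<open>Row p is read only up to entry \<open>Suc m\<close>, covered by the first bound since
  \<open>qpair\<close> is monotone; the second covers the child's entry read by
  \<open>witness\<close>.\<close>

lemma clash_cong:
  assumes "\<forall>i<n. g i = h i" "qpair p (Suc m) < n" "qpair (c (qpair 1 (qpair p m))) 0 < n"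
  shows "clash c g p m \<longleftrightarrow> clash c h p m"
proof -
  have row: "g (qpair p k) = h (qpair p k)" if "k \<le> Suc m" for k
    using assms qpair_mono2[OF that, of p] by auto
  have "witness c g p m \<longleftrightarrow> witness c h p m"
    using assms by (simp add: witness_def)
  moreover have "(\<exists>k<Suc m. g (qpair p (Suc k)) > 0) \<longleftrightarrow> (\<exists>k<Suc m. h (qpair p (Suc k)) > 0)"
    using row by (metis Suc_leI)
  ultimately show ?thesis
    using row[of 0] row[of "Suc m"] by (simp add: clash_def)
qed

lemma radius_ok_near_evaluation:
  assumes ok: "radius_ok c (nat_of_bool_seq g) n" and near: "\<forall>i<n. evaluation i = g i"
    and root: "dec 0 = Nor b" "\<And>m. holds c (b m) \<longleftrightarrow> m = v"
  shows "v < n"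
proof -
  let ?g = "nat_of_bool_seq g"
  let ?e = "nat_of_bool_seq evaluation"
  have near': "\<forall>i<n. ?e i = ?g i" using near by (simp add: nat_of_bool_seq_def)
  have nc: "\<not> (\<exists>p m. clash c ?g p m \<and> qpair p (Suc m) < n \<and> qpair (c (qpair 1 (qpair p m))) 0 < n)"
    using clash_cong[OF near'] no_clash_evaluation by blast
  then have no_clash: "\<not> (\<exists>p m. clash c ?g p m)"
    using ok unfolding radius_ok_def by blast
  have "\<not> (blank ?g p \<and> \<not> (\<exists>q. c (qpair 0 (qpair p q)) > 0 \<and> blank ?g q) \<and> qpair p 0 < n)" for p
  proof
    assume p: "blank ?g p \<and> \<not> (\<exists>q. c (qpair 0 (qpair p q)) > 0 \<and> blank ?g q) \<and> qpair p 0 < n"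
    then have "\<not> blank ?g q" if "(q, p) \<in> below" for q
      using that unfolding below_def by blast
    then have "?g (qpair q 0) > 0 \<longleftrightarrow> true_node q" if "(q, p) \<in> below" for q
      using that trans_below by (intro no_clash_imp_correct[OF no_clash]) (auto dest: transD)
    then have "true_node p \<longleftrightarrow> \<not> (\<exists>m. witness c ?g p m)"
      by (intro true_node_iff) (use child_below in blast)
    \<comment> \<open>A witness against an empty row would already be a clash.\<close>
    moreover have "\<not> witness c ?g p m" for m
      using p no_clash by (auto simp: clash_def blank_def)
    ultimately have "?e (qpair p 0) > 0" by simp
    then show False using near' p by (auto simp: blank_def)
  qed
  then obtain m where m: "m < n" "witness c ?g 0 m" and nonblank: "\<not> (\<exists>p. blank ?g p)"
    using ok nc unfolding radius_ok_def by blast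
  \<comment> \<open>The root is an inner node, so its witness is a true child, and only child v is
    true.\<close>
  have "true_node (c (qpair 1 (qpair 0 m)))"
    using m(2) inner[OF root(1), of m] no_clash_imp_correct[OF no_clash] nonblank
    by (auto simp: witness_def)
  then have "m = v" using inner[OF root(1), of m] root(2) by simp
  then show ?thesis using m by simp
qed

text \<open>This keeps the default 0 of \<open>radius\<close> from occurring at c, where it would
  violate LOC.\<close>

lemma radius_ok_exists:
  assumes root: "dec 0 = Nor b" "holds c (b v)"
  shows "\<exists>n. radius_ok c g n"
proof (cases "\<exists>p m. clash c g p m")
  case True
  then obtain p m where "clash c g p m" by blast
  then have "radius_ok c g (Suc (qpair p (Suc m) + qpair (c (qpair 1 (qpair p m))) 0))"
    unfolding radius_ok_def by (intro disjI1 exI[of _ p] exI[of _ m]) auto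
  then show ?thesis by blast
next
  case no_clash: False
  show ?thesis
  proof (cases "\<exists>p. blank g p")
    case True
    then obtain p where "blank g p" "\<And>q. (q, p) \<in> below \<Longrightarrow> \<not> blank g q"
      using wfE_min[OF wf_below, of _ "{p. blank g p}"] by (metis mem_Collect_eq)
    then have "radius_ok c g (Suc (qpair p 0))"
      using no_clash unfolding radius_ok_def below_def by blast
    then show ?thesis by blast
  next
    case False
    then have "g (qpair (c (qpair 1 (qpair 0 v))) 0) > 0"
      using no_clash_imp_correct[OF no_clash] inner[OF root(1), of v] root(2) by simp
    then have "witness c g 0 v" using inner[OF root(1)] by (auto simp: witness_def)
    then have "radius_ok c g (Suc v)"
      using no_clash False unfolding radius_ok_def by blast
    then show ?thesis by blast
  qed
qed

lemma pincherle_realiser_exceeds: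
  assumes M: "pincherle_realiser M"
    and root: "dec 0 = Nor b" "\<And>m. holds c (b m) \<longleftrightarrow> m = v"
  shows "v < M (\<lambda>g. radius c (nat_of_bool_seq g))"
proof -
  let ?G = "\<lambda>g. radius c (nat_of_bool_seq g)"
  have "\<exists>n. radius_ok c (nat_of_bool_seq g) n" for g
    using radius_ok_exists[OF root(1)] root(2) by blast
  then have ok: "radius_ok c (nat_of_bool_seq g) (?G g)" for g
    by (simp add: radius_def LeastI_ex)
  \<comment> \<open>A spike at \<open>evaluation\<close> respects LOC, since each neighbourhood
    containing that point has radius above v.\<close>
  have "LOC (\<lambda>g. if g = evaluation then Suc v else 0) ?G"
    unfolding LOC_def using radius_ok_near_evaluation[OF ok _ root] by (auto simp: Suc_le_eq)
  then have "\<forall>g. (if g = evaluation then Suc v else 0) \<le> M ?G"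
    using M unfolding pincherle_realiser_def by blast
  from spec[OF this, of evaluation] show ?thesis by simp
qed

end

section \<open>Storing a Borel code in a point\<close>

lemma coded_point_exists: "\<exists>c dec. coded_point c dec \<and> dec 0 = b"
proof -
  define dec where "dec p = subterm b (list_decode p)" for p
  define child where "child p n = list_encode (n # list_decode p)" for p n
  have dec0: "dec 0 = b" by (simp add: dec_def)
  have child: "dec (child p n) = d n" if "dec p = Nor d" for p d n
    using that by (simp add: dec_def child_def)
  define unpair where "unpair = inv (\<lambda>(a, b). qpair a b)"
  have "inj (\<lambda>(a, b). qpair a b)" by (auto simp: inj_def)
  then have unpair: "unpair (qpair a b) = (a, b)" for a b
    using inv_f_f[of "\<lambda>(a, b). qpair a b" "(a, b)"] by (simp add: unpair_def)
  \<comment> \<open>No effectivity is asked of c, so even the transitive closure is stored as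
    data.\<close>
  define c where "c x = (case unpair x of (t, y) \<Rightarrow>
      if t = 0 then (case unpair y of (p, q) \<Rightarrow> of_bool ((dec q, dec p) \<in> subcode\<^sup>+))
      else if t = 1 then (case unpair y of (p, m) \<Rightarrow> child p m)
      else if t = 2 then (case dec y of Test i j \<Rightarrow> Suc j | Nor _ \<Rightarrow> 0)
      else (case dec y of Test i j \<Rightarrow> i | Nor _ \<Rightarrow> 0))" for x
  have "coded_point c dec"
    by unfold_locales (simp_all add: c_def unpair child)
  with dec0 show ?thesis by blast
qed

theorem theorem3p2:
  shows "\<exists>F :: (nat \<Rightarrow> nat) \<Rightarrow> (nat \<Rightarrow> nat) \<Rightarrow> nat. arithmetical2 F \<and>
    (\<forall>M. pincherle_realiser M \<longrightarrow>
       (\<lambda>f. M (\<lambda>g. F f (nat_of_bool_seq g))) \<notin> borel_measurable (borel :: (nat \<Rightarrow> nat) measure))"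
proof (intro exI[of _ radius] conjI allI impI notI arithmetical2_radius)
  fix M :: "((nat \<Rightarrow> bool) \<Rightarrow> nat) \<Rightarrow> nat"
  define H where "H = (\<lambda>f. M (\<lambda>g. radius f (nat_of_bool_seq g)))"
  assume M: "pincherle_realiser M"
    and "(\<lambda>f. M (\<lambda>g. radius f (nat_of_bool_seq g))) \<in> borel_measurable borel"
  then have "H \<in> borel_measurable borel" by (simp add: H_def)
  then have "H -` {m} \<in> sets borel" for m
    using measurable_sets[of H borel borel "{m}"] by simp
  then have "\<forall>m. \<exists>d. H -` {m} = {x. holds x d}"
    using borel_imp_bcode by blast
  then obtain b where b: "\<And>m. H -` {m} = {x. holds x (b m)}"
    using choice[of "\<lambda>m d. H -` {m} = {x. holds x d}"] by blast
  \<comment> \<open>Diagonalisation: c stores the codes of all fibres of H, and these are evaluated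
    at c itself.\<close>
  obtain c dec where "coded_point c dec" "dec 0 = Nor b"
    using coded_point_exists by blast
  moreover have "holds c (b m) \<longleftrightarrow> m = H c" for m
    using b[of m] by auto
  ultimately have "H c < M (\<lambda>g. radius c (nat_of_bool_seq g))"
    using coded_point.pincherle_realiser_exceeds[OF _ M] by blast
  then show False by (simp add: H_def)
qed

end
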